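(* Let $\mathcal{A}$ be a regular Baer *-ring ordered by $\preceq^{\alpha}$, where $\alpha\in\{r*|\ell\square,\ r*|r\square,\ r*|\square,\ *|\ell\square,\ *|r\square,\ *|\square\}$. If $b\in\mathcal{A}$ is an upper bound (with respect to $\preceq^{\alpha}$) of a nonempty subset $B\subseteq\mathcal{A}$, then: (a) $b\left(\bigvee\{\mathrm{rp}(c): c\in B\}\right)$ is the least upper bound of $B$ in $[0,b]^{\alpha}$; (b) $b\left(\bigwedge\{\mathrm{rp}(c): c\in B\}\right)$ is the greatest lower bound of $B$ in $[0,b]^{\alpha}$. Here $[0,b]^{\alpha}=\{a\in\mathcal{A}: a\preceq^{\alpha}b\}$ is ordered by $\preceq^{\alpha}$, and $\bigvee$, $\bigwedge$ of sets of self-adjoint idempotents are taken in the complete lattice $E(\mathcal{A})$.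
   Context: A *-ring is an (associative) ring $\mathcal{A}$ with an involution $*$: $(a+b)^*=a^*+b^*$, $(ab)^*=b^*a^*$, $(a^* )^*=a$. A Baer *-ring is a *-ring in which the right annihilator of every subset is a principal right ideal generated by a self-adjoint idempotent ($p=p^*=p^2$). Let $E(\mathcal{A})$ be the set of self-adjoint idempotents, partially ordered by $p\le q$ iff $p=pq$. A Baer *-ring has an identity $1$ and is a Rickart *-ring: for every $a$ there are unique self-adjoint idempotents $\mathrm{lp}(a)$, $\mathrm{rp}(a)$ with $\{x: xa=0\}=\mathcal{A}(1-\mathrm{lp}(a))$ and $\{x: ax=0\}=(1-\mathrm{rp}(a))\mathcal{A}$; moreover it is known that $E(\mathcal{A})$ is a complete lattice. The ring is regular if for every $a\in\mathcal{A}$ there is $a^-\in\mathcal{A}$ with $aa^-a=a$. Base relations: $a\preceq^{r*} b$ iff $a\,\mathrm{rp}(b)=a=b\,\mathrm{rp}(a)$; $a\preceq^{*} b$ iff $\mathrm{lp}(a)b=a=b\,\mathrm{rp}(a)$. For $\beta\in\{r*,*\}$: $a\preceq^{\beta|\ell\square} b$ iff $a\preceq^{\beta}b$ and $a^2=ab$; $a\preceq^{\beta|r\square} b$ iff $a\preceq^{\beta}b$ and $a^2=ba$; $a\preceq^{\beta|\square} b$ iff $a\preceq^{\beta}b$ and $a^2=ab=ba$. All of these are partial orders on $\mathcal{A}$. *)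

theory Defs
  imports "HOL-Algebra.Complete_Lattice"
begin

section \<open>Baer star-rings\<close>

text \<open>Neither commutativity nor an identity is part of the class \<^class>\<open>ring\<close>.\<close>

locale star_ring =
  fixes star :: "'a::ring \<Rightarrow> 'a"
  assumes star_add: "star (a + b) = star a + star b"
    and star_mult: "star (a * b) = star b * star a"
    and star_star: "star (star a) = a"

definition projections :: "('a::ring \<Rightarrow> 'a) \<Rightarrow> 'a set" where
  "projections star = {p. star p = p \<and> p * p = p}"

text \<open>For an idempotent \<open>p\<close>, the principal right ideal generated by \<open>p\<close> is \<open>range ((*) p)\<close>
  (it contains \<open>p\<close>), even if no identity is available.\<close>

locale baer_star_ring = star_ring +
  assumes right_annihilator:
    "\<exists>p\<in>projections star. {x. \<forall>s\<in>S. s * x = 0} = range ((*) p)"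

locale regular_baer_star_ring = baer_star_ring star for star :: "'a::ring \<Rightarrow> 'a" +
  assumes regular: "\<exists>x. a * x * a = (a::'a)"

definition unity :: "'a::ring" where
  "unity = (THE e. \<forall>x. e * x = x \<and> x * e = x)"

definition lp :: "('a::ring \<Rightarrow> 'a) \<Rightarrow> 'a \<Rightarrow> 'a" where
  "lp star a = (THE p. p \<in> projections star \<and> {x. x * a = 0} = range (\<lambda>y. y * (unity - p)))"

definition rp :: "('a::ring \<Rightarrow> 'a) \<Rightarrow> 'a \<Rightarrow> 'a" where
  "rp star a = (THE p. p \<in> projections star \<and> {x. a * x = 0} = range (\<lambda>y. (unity - p) * y))"

definition proj_order :: "('a::ring \<Rightarrow> 'a) \<Rightarrow> 'a gorder" where
  "proj_order star = \<lparr>carrier = projections star, eq = (=), le = (\<lambda>p q. p = p * q)\<rparr>"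

section \<open>The partial orders\<close>

datatype base_kind = RStar | Star

datatype square_kind = LeftSquare | RightSquare | Square

fun base_le :: "('a::ring \<Rightarrow> 'a) \<Rightarrow> base_kind \<Rightarrow> 'a \<Rightarrow> 'a \<Rightarrow> bool" where
  "base_le star RStar a b \<longleftrightarrow> a * rp star b = a \<and> a = b * rp star a"
| "base_le star Star a b \<longleftrightarrow> lp star a * b = a \<and> a = b * rp star a"

fun square_cond :: "square_kind \<Rightarrow> 'a::ring \<Rightarrow> 'a \<Rightarrow> bool" where
  "square_cond LeftSquare a b \<longleftrightarrow> a * a = a * b"
| "square_cond RightSquare a b \<longleftrightarrow> a * a = b * a"
| "square_cond Square a b \<longleftrightarrow> a * a = a * b \<and> a * b = b * a"

definition sq_le :: "('a::ring \<Rightarrow> 'a) \<Rightarrow> base_kind \<times> square_kind \<Rightarrow> 'a \<Rightarrow> 'a \<Rightarrow> bool" where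
  "sq_le star \<alpha> a b \<longleftrightarrow> base_le star (fst \<alpha>) a b \<and> square_cond (snd \<alpha>) a b"

definition initial_segment ::
  "('a::ring \<Rightarrow> 'a) \<Rightarrow> base_kind \<times> square_kind \<Rightarrow> 'a \<Rightarrow> 'a gorder" where
  "initial_segment star \<alpha> b =
     \<lparr>carrier = {a. sq_le star \<alpha> a b}, eq = (=), le = sq_le star \<alpha>\<rparr>"

section \<open>Well-definedness of the choices above\<close>

context baer_star_ring
begin

lemma star_zero: "star 0 = 0"
  using star_add[of 0 0] by simp

lemma star_diff: "star (a - b) = star a - star b"
  using star_add[of "a - b" b] by (simp add: algebra_simps)

lemma unity_ex1: "\<exists>!e::'a. \<forall>x. e * x = x \<and> x * e = x"
proof -
  obtain e where e: "e \<in> projections star" "{x. \<forall>s\<in>{}. s * x = 0} = range ((*) e)"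
    using right_annihilator[of "{}"] by blast
  have l: "e * x = x" for x
  proof -
    have "x \<in> range ((*) e)" using e(2) by auto
    then obtain y where "x = e * y" by auto
    then show ?thesis using e(1) by (simp add: projections_def mult.assoc[symmetric])
  qed
  have r: "x * e = x" for x
  proof -
    have "star (x * e) = star x"
      using e(1) l by (simp add: star_mult projections_def)
    then show ?thesis by (metis star_star)
  qed
  show ?thesis using l r by (intro ex1I[of _ e]) (auto, metis)
qed

lemma unity_left [simp]: "unity * (x::'a) = x"
  and unity_right [simp]: "(x::'a) * unity = x"
  using theI'[OF unity_ex1] by (auto simp: unity_def)

lemma unity_projection: "unity \<in> projections star"
proof -
  have "star unity = unity" by (metis star_mult star_star unity_left unity_right)
  then show ?thesis by (simp add: projections_def)
qed

lemma compl_projection: "p \<in> projections star \<Longrightarrow> unity - p \<in> projections star"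
  using unity_projection by (auto simp: projections_def star_diff algebra_simps)

lemma rp_ex1:
  "\<exists>!p. p \<in> projections star \<and> {x. a * x = 0} = range (\<lambda>y. (unity - p) * y)"
proof -
  obtain e where e: "e \<in> projections star" "{x. \<forall>s\<in>{a}. s * x = 0} = range ((*) e)"
    using right_annihilator[of "{a}"] by blast
  show ?thesis
  proof (intro ex1I[of _ "unity - e"] conjI)
    show "unity - e \<in> projections star" by (rule compl_projection[OF e(1)])
    show "{x. a * x = 0} = range (\<lambda>y. (unity - (unity - e)) * y)" using e(2) by simp
  next
    fix q assume q: "q \<in> projections star \<and> {x. a * x = 0} = range (\<lambda>y. (unity - q) * y)"
    define f where "f = unity - q"
    have f: "f \<in> projections star" using q compl_projection f_def by blast
    have eq: "range ((*) e) = range ((*) f)" using q e(2) by (simp add: f_def)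
    have "e * e \<in> range ((*) f)" "f * f \<in> range ((*) e)" using eq by auto
    then have fe: "f * e = e" and ef: "e * f = f"
      using e(1) f by (auto simp: projections_def image_iff mult.assoc[symmetric])
         (metis mult.assoc)+
    have "star (f * e) = star e" using fe by simp
    then have "e * f = e" using e(1) f by (simp add: star_mult projections_def)
    then have "e = f" using ef by simp
    then show "q = unity - e" by (simp add: f_def)
  qed
qed

lemma rp_projection: "rp star a \<in> projections star"
  and rp_annihilator: "{x. a * x = 0} = range (\<lambda>y. (unity - rp star a) * y)"
  using theI'[OF rp_ex1[of a]] by (auto simp: rp_def)

lemma left_right_annihilator:
  assumes "p \<in> projections star"
  shows "{x. x * a = 0} = range (\<lambda>y. y * (unity - p)) \<longleftrightarrow>
    {x. star a * x = 0} = range (\<lambda>y. (unity - p) * y)"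
proof -
  have c: "star (unity - p) = unity - p"
    using compl_projection[OF assms] by (simp add: projections_def)
  have ann: "{x. star a * x = 0} = star ` {x. x * a = 0}"
    by (auto simp: image_iff) (metis star_mult star_star star_zero)+
  have rng: "range (\<lambda>y. (unity - p) * y) = star ` range (\<lambda>y. y * (unity - p))"
  proof (rule Set.set_eqI)
    fix x
    have "x \<in> range (\<lambda>y. (unity - p) * y) \<longleftrightarrow> (\<exists>y. x = star (star y * (unity - p)))"
      by (auto simp: star_mult star_star c)
    also have "\<dots> \<longleftrightarrow> (\<exists>y. x = star (y * (unity - p)))" by (metis star_star)
    finally show "x \<in> range (\<lambda>y. (unity - p) * y) \<longleftrightarrow> x \<in> star ` range (\<lambda>y. y * (unity - p))"
      by auto
  qed
  have "inj star" by (metis injI star_star)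
  then show ?thesis using ann rng by (simp add: inj_image_eq_iff)
qed

lemma lp_eq_rp_star: "lp star a = rp star (star a)"
  unfolding lp_def rp_def using left_right_annihilator[of _ a]
  by (intro arg_cong[where f = The] ext conj_cong) auto

lemma lp_projection: "lp star a \<in> projections star"
  and lp_annihilator: "{x. x * a = 0} = range (\<lambda>y. y * (unity - lp star a))"
  using rp_projection[of "star a"] rp_annihilator[of "star a"]
    left_right_annihilator[of "lp star a" a]
  by (simp_all add: lp_eq_rp_star)

lemma projection_le_flip:
  assumes "p \<in> projections star" "q \<in> projections star"
  shows "p = p * q \<longleftrightarrow> p = q * p"
  using assms by (auto simp: projections_def) (metis star_mult)+

lemma projection_order: "partial_order (proj_order star)"
proof
  fix x y z
  assume "x \<sqsubseteq>\<^bsub>proj_order star\<^esub> y" "y \<sqsubseteq>\<^bsub>proj_order star\<^esub> z"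
  then have "x = x * y" "y = y * z" by (auto simp: proj_order_def)
  then show "x \<sqsubseteq>\<^bsub>proj_order star\<^esub> z" by (simp add: proj_order_def) (metis mult.assoc)
next
  fix x y
  assume "x \<sqsubseteq>\<^bsub>proj_order star\<^esub> y" "y \<sqsubseteq>\<^bsub>proj_order star\<^esub> x"
    "x \<in> carrier (proj_order star)" "y \<in> carrier (proj_order star)"
  then show "x .=\<^bsub>proj_order star\<^esub> y"
    using projection_le_flip[of x y] by (simp add: proj_order_def)
qed (auto simp: proj_order_def projections_def)

lemma projection_sup_exists:
  assumes "A \<subseteq> projections star"
  shows "\<exists>s. least (proj_order star) s (Upper (proj_order star) A)"
proof -
  obtain e where e: "e \<in> projections star" "{x. \<forall>s\<in>A. s * x = 0} = range ((*) e)"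
    using right_annihilator[of A] by blast
  have mem: "(\<forall>s\<in>A. s * x = 0) \<longleftrightarrow> x = e * x" for x
  proof -
    have "(\<forall>s\<in>A. s * x = 0) \<longleftrightarrow> x \<in> range ((*) e)" using e(2) by blast
    also have "\<dots> \<longleftrightarrow> x = e * x" using e(1)
      by (auto simp: projections_def mult.assoc[symmetric])
    finally show ?thesis .
  qed
  have upper: "(\<forall>s\<in>A. s = s * q) \<longleftrightarrow> unity - q = e * (unity - q)" for q
    using mem[of "unity - q"] by (simp add: algebra_simps)
  have "unity - e \<in> projections star" by (rule compl_projection[OF e(1)])
  moreover have "\<forall>s\<in>A. s = s * (unity - e)"
    using upper[of "unity - e"] e(1) by (simp add: projections_def)
  moreover have "unity - e = (unity - e) * q" if "\<forall>s\<in>A. s = s * q" for q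
    using upper[of q] that by (simp add: algebra_simps)
  ultimately show ?thesis using assms
    by (intro exI[of _ "unity - e"]) (auto simp: least_def Upper_def proj_order_def)
qed

lemma projection_inf_exists:
  assumes "A \<subseteq> projections star"
  shows "\<exists>i. greatest (proj_order star) i (Lower (proj_order star) A)"
proof -
  let ?L = "Lower (proj_order star) A"
  have "?L \<subseteq> projections star" by (auto simp: Lower_def proj_order_def)
  then obtain i where i: "least (proj_order star) i (Upper (proj_order star) ?L)"
    using projection_sup_exists by blast
  have "A \<subseteq> Upper (proj_order star) ?L"
    using assms by (auto simp: Upper_def Lower_def proj_order_def)
  then have "i \<in> ?L" using i assms by (auto simp: least_def Lower_def Upper_def)
  then show ?thesis using i
    by (intro exI[of _ i]) (auto simp: greatest_def least_def Lower_def Upper_def)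
qed

lemma projection_complete_lattice: "complete_lattice (proj_order star)"
proof -
  interpret partial_order "proj_order star" by (rule projection_order)
  show ?thesis
    using projection_sup_exists projection_inf_exists
    by unfold_locales (auto simp: proj_order_def)
qed

end

end

theory Submission
  imports Defs
begin

text \<open>
  The map \<open>p \<mapsto> b p\<close> is an order isomorphism onto \<open>[0, b]\<close> from the set of those projections
  \<open>p \<le> rp(b)\<close> that satisfy the following conditions, depending on \<open>\<alpha>\<close>: the left square
  condition is \<open>p b p = p b\<close>, the right square condition is \<open>p b p = rp(b) b p\<close>, and the star
  order requires a projection \<open>q\<close> with \<open>q b = b p\<close>. Since \<open>x (\<Squnion> p\<^sub>i) = 0\<close> as soon as all
  \<open>x p\<^sub>i = 0\<close> and \<open>x (\<Sqinter> p\<^sub>i) = x\<close> as soon as all \<open>x p\<^sub>i = x\<close> (and likewise on the left), each of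
  these conditions passes from a nonempty family to its supremum and its infimum.
\<close>

section \<open>Right and left projections as annihilators\<close>

context baer_star_ring
begin

lemma projectionD:
  assumes "p \<in> projections star"
  shows "star p = p" and "p * p = p" and "p * (p * x) = p * x"
  using assms by (auto simp: projections_def mult.assoc[symmetric])

text \<open>The right annihilator of \<open>a\<close> is the range of the complement of
  \<open>rp star a\<close>. So a left factor \<open>a\<close> in an equation can be traded for the
  projection \<open>rp star a\<close>.\<close>

lemma mult_eq_0_iff_rp: "a * x = 0 \<longleftrightarrow> rp star a * x = 0"
proof -
  have "a * x = 0 \<longleftrightarrow> x \<in> range (\<lambda>y. (unity - rp star a) * y)"
    using rp_annihilator[of a] by blast
  also have "\<dots> \<longleftrightarrow> rp star a * x = 0"
  proof
    assume "rp star a * x = 0"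
    then have "x = (unity - rp star a) * x" by (simp add: algebra_simps)
    then show "x \<in> range (\<lambda>y. (unity - rp star a) * y)" by blast
  qed (auto simp: algebra_simps projectionD(3)[OF rp_projection])
  finally show ?thesis .
qed

lemma mult_eq_iff_rp: "a * x = a * y \<longleftrightarrow> rp star a * x = rp star a * y"
  using mult_eq_0_iff_rp[of a "x - y"] by (simp add: algebra_simps)

lemma mult_rp [simp]: "a * rp star a = a"
  using mult_eq_iff_rp[of a "rp star a" unity] projectionD[OF rp_projection[of a]] by simp

lemma mult_projection_eq_iff: "a * p = a \<longleftrightarrow> rp star a = rp star a * p"
  using mult_eq_iff_rp[of a p unity] by auto

text \<open>Since \<open>p = rp star b * p\<close>, the elements \<open>b * p\<close> and
  \<open>p\<close> have the same right annihilator. Hence \<open>rp\<close> inverts the map from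
  \<open>p\<close> to \<open>b * p\<close>.\<close>

lemma rp_mult_projection:
  assumes "p \<in> projections star" and "p = p * rp star b"
  shows "rp star (b * p) = p"
proof -
  have "p = rp star b * p"
    using assms projection_le_flip rp_projection by blast
  then have ann: "b * p * x = 0 \<longleftrightarrow> p * x = 0" for x
    using mult_eq_0_iff_rp[of b "p * x"] by (metis mult.assoc)
  \<comment> \<open>The second equation gives \<open>p\<close> \<le> \<open>rp star (b * p)\<close>;
    the first, carried over by \<open>ann\<close>, gives the converse.\<close>
  have "p * (unity - p) = 0" "p * (unity - rp star (b * p)) = 0"
    using ann[of "unity - rp star (b * p)"] projectionD[OF assms(1)]
    by (auto simp: algebra_simps)
  moreover from this have "rp star (b * p) * (unity - p) = 0"
    using ann mult_eq_0_iff_rp by blast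
  ultimately show ?thesis
    using projection_le_flip[OF assms(1) rp_projection[of "b * p"]]
    by (simp add: algebra_simps)
qed

lemma lp_mult [simp]: "lp star a * a = a"
  by (metis lp_eq_rp_star lp_projection mult_rp projectionD(1) star_mult star_star)

lemma projection_mult_lp:
  assumes "q \<in> projections star" and "q * a = a"
  shows "lp star a * q = lp star a"
proof -
  have "star a * q = star a"
    using assms projectionD(1) by (metis star_mult)
  then show ?thesis
    by (simp add: lp_eq_rp_star mult_projection_eq_iff)
qed

text \<open>Such a \<open>q\<close> fixes \<open>b * p\<close>, so it dominates
  \<open>lp star (b * p)\<close>. Unlike the condition on \<open>lp\<close>, the existence of some
  \<open>q\<close> can be followed through suprema and infima.\<close>

lemma lp_mult_eq_iff:
  assumes "p \<in> projections star"
  shows "lp star (b * p) * b = b * p \<longleftrightarrow> (\<exists>q\<in>projections star. q * b = b * p)"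
proof
  assume "\<exists>q\<in>projections star. q * b = b * p"
  then obtain q where q: "q \<in> projections star" "q * b = b * p" by blast
  have "q * (b * p) = b * p"
    using q projectionD(3)[OF q(1), of b] by simp
  from projection_mult_lp[OF q(1) this]
  have "lp star (b * p) * b = lp star (b * p) * (q * b)"
    by (simp add: mult.assoc[symmetric])
  then show "lp star (b * p) * b = b * p" by (simp add: q(2))
qed (use lp_projection in blast)

section \<open>The orders below \<open>b\<close> in terms of projections\<close>

lemma sq_leD:
  assumes "sq_le star \<alpha> a b"
  shows "rp star a = rp star a * rp star b" and "b * rp star a = a"
proof -
  have a: "b * rp star a = a"
    using assms by (cases "fst \<alpha>") (auto simp: sq_le_def)
  moreover have "a * rp star b = a"
  proof (cases "fst \<alpha>")
    case Star
    \<comment> \<open>Right multiplication by \<open>rp star b\<close> leaves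
      \<open>lp star a * b\<close>, that is \<open>a\<close>, unchanged.\<close>
    then have "lp star a * b = a" using assms by (simp add: sq_le_def)
    then show ?thesis by (metis mult.assoc mult_rp)
  qed (use assms in \<open>simp add: sq_le_def\<close>)
  ultimately show "rp star a = rp star a * rp star b" "b * rp star a = a"
    by (simp_all add: mult_projection_eq_iff)
qed

lemma sq_le_mult_iff:
  assumes p: "p \<in> projections star" and le: "p = p * rp star b"
  shows "sq_le star \<alpha> (b * p) b \<longleftrightarrow>
    (fst \<alpha> = Star \<longrightarrow> (\<exists>q\<in>projections star. q * b = b * p)) \<and>
    (snd \<alpha> \<noteq> RightSquare \<longrightarrow> p * b * p = p * b) \<and>
    (snd \<alpha> \<noteq> LeftSquare \<longrightarrow> p * b * p = rp star b * b * p)"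
proof -
  have rp: "rp star (b * p) = p" by (rule rp_mult_projection[OF p le])
  have flip: "rp star b * p = p"
    using le projection_le_flip[OF p rp_projection] by metis
  have "base_le star (fst \<alpha>) (b * p) b \<longleftrightarrow>
      (fst \<alpha> = Star \<longrightarrow> (\<exists>q\<in>projections star. q * b = b * p))"
    using le lp_mult_eq_iff[OF p, of b]
    by (cases "fst \<alpha>") (simp_all add: rp mult.assoc)
  \<comment> \<open>The left factor \<open>b * p\<close> cancels to its right projection
    \<open>p\<close>; in \<open>right\<close> below, \<open>b\<close> cancels to
    \<open>rp star b\<close>.\<close>
  moreover have left: "b * p * (b * p) = b * p * b \<longleftrightarrow> p * b * p = p * b"
    using mult_eq_iff_rp[of "b * p" "b * p" b] by (simp add: rp mult.assoc)
  moreover have right: "b * p * (b * p) = b * (b * p) \<longleftrightarrow> p * b * p = rp star b * b * p"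
    using mult_eq_iff_rp[of b "p * (b * p)" "b * p"] flip by (metis mult.assoc)
  ultimately show ?thesis
    unfolding sq_le_def by (cases "snd \<alpha>") auto
qed

text \<open>Below \<open>b\<close> an element is recovered from its right projection as
  \<open>a = b * rp star a\<close>, so the conditions relative to \<open>b\<close> restrict to
  conditions relative to \<open>c = b * rp star c\<close>.\<close>

lemma sq_le_interval_iff:
  assumes a: "sq_le star \<alpha> a b" and c: "sq_le star \<alpha> c b"
  shows "sq_le star \<alpha> a c \<longleftrightarrow> rp star a = rp star a * rp star c"
proof
  assume le: "rp star a = rp star a * rp star c"
  let ?p = "rp star a" and ?q = "rp star c"
  have flip: "?q * ?p = ?p"
    using le projection_le_flip[OF rp_projection rp_projection] by metis
  have aq: "a * ?q = a" using le by (simp add: mult_projection_eq_iff)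
  have cp: "c * ?p = a"
    using sq_leD(2)[OF a] sq_leD(2)[OF c] flip by (metis mult.assoc)
  have l: "a * c = a * a" if "a * b = a * a"
    using that sq_leD(2)[OF c] aq by (metis mult.assoc)
  have r: "c * a = a * a" if "b * a = a * a"
  proof -
    \<comment> \<open>As \<open>a = b * ?p\<close>, the hypothesis reads
      \<open>b * (?p * a) = b * a\<close>, and \<open>b\<close> cancels to \<open>rp star b\<close>,
      which fixes \<open>?p\<close>.\<close>
    have "?p * a = rp star b * a"
      using that sq_leD(2)[OF a] mult_eq_iff_rp[of b "?p * a" a]
        sq_leD(1)[OF a] projection_le_flip[OF rp_projection rp_projection]
      by (metis mult.assoc)
    then have "c * a = c * (?p * a)"
      using sq_leD(1)[OF c] by (metis mult.assoc mult_rp)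
    then show ?thesis using cp by (metis mult.assoc)
  qed
  have "lp star a * c = a" if "lp star a * b = a"
    using that sq_leD(2)[OF c] aq by (metis mult.assoc)
  then have "base_le star (fst \<alpha>) a c"
    using a aq cp by (cases "fst \<alpha>") (auto simp: sq_le_def)
  moreover have "square_cond (snd \<alpha>) a c"
    using a l r by (cases "snd \<alpha>") (auto simp: sq_le_def)
  ultimately show "sq_le star \<alpha> a c" by (simp add: sq_le_def)
qed (rule sq_leD)

end

section \<open>Annihilation and absorption for suprema and infima of projections\<close>

locale projection_family = baer_star_ring star for star :: "'a::ring \<Rightarrow> 'a" +
  fixes A :: "'a set"
  assumes family: "A \<subseteq> projections star"
begin

abbreviation "psup \<equiv> \<Squnion>\<^bsub>proj_order star\<^esub> A"
abbreviation "pinf \<equiv> \<Sqinter>\<^bsub>proj_order star\<^esub> A"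

lemma
  shows psup_projection: "psup \<in> projections star"
    and psup_upper: "p \<in> A \<Longrightarrow> p = p * psup"
    and psup_least: "q \<in> projections star \<Longrightarrow> (\<And>p. p \<in> A \<Longrightarrow> p = p * q) \<Longrightarrow> psup = psup * q"
proof -
  \<comment> \<open>\<open>\<Squnion>\<close> is a Hilbert choice of a least upper bound, so
    existence suffices.\<close>
  have "least (proj_order star) psup (Upper (proj_order star) A)"
    unfolding sup_def using someI_ex[OF projection_sup_exists[OF family]] .
  then show "psup \<in> projections star" "p \<in> A \<Longrightarrow> p = p * psup"
    "q \<in> projections star \<Longrightarrow> (\<And>p. p \<in> A \<Longrightarrow> p = p * q) \<Longrightarrow> psup = psup * q"
    using family by (auto simp: least_def Upper_def proj_order_def)
qed

lemma
  shows pinf_projection: "pinf \<in> projections star"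
    and pinf_lower: "p \<in> A \<Longrightarrow> pinf = pinf * p"
    and pinf_greatest: "q \<in> projections star \<Longrightarrow> (\<And>p. p \<in> A \<Longrightarrow> q = q * p) \<Longrightarrow> q = q * pinf"
proof -
  have "greatest (proj_order star) pinf (Lower (proj_order star) A)"
    unfolding inf_def using someI_ex[OF projection_inf_exists[OF family]] .
  then show "pinf \<in> projections star" "p \<in> A \<Longrightarrow> pinf = pinf * p"
    "q \<in> projections star \<Longrightarrow> (\<And>p. p \<in> A \<Longrightarrow> q = q * p) \<Longrightarrow> q = q * pinf"
    using family by (auto simp: greatest_def Lower_def proj_order_def)
qed

lemma member_projection: "p \<in> A \<Longrightarrow> p \<in> projections star"
  using family by blast

lemma psup_upper': "p \<in> A \<Longrightarrow> p = psup * p"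
  using psup_upper projection_le_flip member_projection psup_projection by blast

lemma pinf_lower': "p \<in> A \<Longrightarrow> pinf = p * pinf"
  using pinf_lower projection_le_flip member_projection pinf_projection by blast

text \<open>Each \<open>p\<close> lies below the projection \<open>unity - rp star x\<close>, hence
  so does the supremum.\<close>

lemma mult_psup_eq_0:
  assumes "\<And>p. p \<in> A \<Longrightarrow> x * p = 0"
  shows "x * psup = 0"
proof -
  have "p = p * (unity - rp star x)" if "p \<in> A" for p
  proof -
    have "p = (unity - rp star x) * p"
      using assms[OF that] mult_eq_0_iff_rp[of x p] by (simp add: algebra_simps)
    then show ?thesis
      using projection_le_flip member_projection[OF that] compl_projection rp_projection by blast
  qed
  then have "psup = psup * (unity - rp star x)"
    using psup_least compl_projection rp_projection by blast
  then have "psup = (unity - rp star x) * psup"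
    using projection_le_flip psup_projection compl_projection rp_projection by blast
  then show ?thesis
    using mult_eq_0_iff_rp[of x psup] by (simp add: algebra_simps)
qed

text \<open>The assumption says that \<open>rp star x\<close> is a lower bound of
  \<open>A\<close>.\<close>

lemma mult_pinf_eq:
  assumes "\<And>p. p \<in> A \<Longrightarrow> x * p = x"
  shows "x * pinf = x"
  using pinf_greatest[of "rp star x"] assms rp_projection by (simp add: mult_projection_eq_iff)

lemma psup_mult_eq_0:
  assumes "\<And>p. p \<in> A \<Longrightarrow> p * x = 0"
  shows "psup * x = 0"
proof -
  have "star x * p = 0" if "p \<in> A" for p
    using assms[OF that] projectionD(1)[OF member_projection[OF that]] by (metis star_mult star_zero)
  then have "star x * psup = 0" by (rule mult_psup_eq_0)
  then show ?thesis
    using projectionD(1)[OF psup_projection] by (metis star_mult star_star star_zero)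
qed

lemma pinf_mult_eq:
  assumes "\<And>p. p \<in> A \<Longrightarrow> p * x = x"
  shows "pinf * x = x"
proof -
  have "star x * p = star x" if "p \<in> A" for p
    using assms[OF that] projectionD(1)[OF member_projection[OF that]] by (metis star_mult)
  then have "star x * pinf = star x" by (rule mult_pinf_eq)
  then show ?thesis
    using projectionD(1)[OF pinf_projection] by (metis star_mult star_star)
qed

lemma psup_eqI:
  assumes "\<And>p. p \<in> A \<Longrightarrow> x * p = y * p"
  shows "x * psup = y * psup"
  using mult_psup_eq_0[of "x - y"] assms by (simp add: algebra_simps)

lemma psup_eqI':
  assumes "\<And>p. p \<in> A \<Longrightarrow> p * x = p * y"
  shows "psup * x = psup * y"
  using psup_mult_eq_0[of "x - y"] assms by (simp add: algebra_simps)

end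

section \<open>Closure of the order conditions under suprema and infima\<close>

context baer_star_ring
begin

text \<open>A \<open>q\<close> belonging to \<open>p\<close> need not be unique, so
  \<open>?Q\<close> collects all of them. The product \<open>Q.psup * b * P.psup\<close> equals both
  \<open>Q.psup * b\<close> and \<open>b * P.psup\<close>, which is tested on the members of
  \<open>?Q\<close> and of \<open>A\<close>.\<close>

lemma intertwining_sup:
  assumes A: "A \<subseteq> projections star"
    and ex: "\<And>p. p \<in> A \<Longrightarrow> \<exists>q\<in>projections star. q * b = b * p"
  shows "\<exists>q\<in>projections star. q * b = b * \<Squnion>\<^bsub>proj_order star\<^esub> A"
proof -
  let ?Q = "{q\<in>projections star. \<exists>p\<in>A. q * b = b * p}"
  interpret P: projection_family star A by unfold_locales (rule A)
  interpret Q: projection_family star ?Q by unfold_locales blast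
  have "Q.psup * (b * P.psup) = Q.psup * b"
  proof (rule Q.psup_eqI')
    fix q assume "q \<in> ?Q"
    then obtain p where p: "p \<in> A" "q * b = b * p" by blast
    show "q * (b * P.psup) = q * b"
      using p P.psup_upper[OF p(1)] by (metis mult.assoc)
  qed
  moreover have "(Q.psup * b) * P.psup = b * P.psup"
  proof (rule P.psup_eqI)
    fix p assume p: "p \<in> A"
    then obtain q where q: "q \<in> projections star" "q * b = b * p" using ex by blast
    then have "q = Q.psup * q" using p by (intro Q.psup_upper') blast
    moreover have "(Q.psup * b) * p = (Q.psup * q) * b"
      by (simp add: q(2) mult.assoc)
    ultimately show "(Q.psup * b) * p = b * p" using q(2) by simp
  qed
  ultimately have "Q.psup * b = b * P.psup" by (simp add: mult.assoc)
  then show ?thesis using Q.psup_projection by blast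
qed

text \<open>The product \<open>Q.pinf * b * P.pinf\<close> is again evaluated from both sides, now
  by absorption instead of testing on members.\<close>

lemma intertwining_inf:
  assumes A: "A \<subseteq> projections star"
    and ex: "\<And>p. p \<in> A \<Longrightarrow> \<exists>q\<in>projections star. q * b = b * p"
  shows "\<exists>q\<in>projections star. q * b = b * \<Sqinter>\<^bsub>proj_order star\<^esub> A"
proof -
  let ?Q = "{q\<in>projections star. \<exists>p\<in>A. q * b = b * p}"
  interpret P: projection_family star A by unfold_locales (rule A)
  interpret Q: projection_family star ?Q by unfold_locales blast
  have "Q.pinf * (b * P.pinf) = b * P.pinf"
  proof (rule Q.pinf_mult_eq)
    fix q assume "q \<in> ?Q"
    then obtain p where p: "p \<in> A" "q * b = b * p" by blast
    show "q * (b * P.pinf) = b * P.pinf"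
      using p P.pinf_lower'[OF p(1)] by (metis mult.assoc)
  qed
  moreover have "(Q.pinf * b) * P.pinf = Q.pinf * b"
  proof (rule P.mult_pinf_eq)
    fix p assume p: "p \<in> A"
    then obtain q where q: "q \<in> projections star" "q * b = b * p" using ex by blast
    then have "Q.pinf = Q.pinf * q" using p by (intro Q.pinf_lower) blast
    moreover have "(Q.pinf * b) * p = (Q.pinf * q) * b"
      by (simp add: q(2) mult.assoc)
    ultimately show "(Q.pinf * b) * p = Q.pinf * b" by simp
  qed
  ultimately have "Q.pinf * b = b * P.pinf" by (simp add: mult.assoc)
  then show ?thesis using Q.pinf_projection by blast
qed

lemma sq_le_sup:
  assumes A: "A \<subseteq> projections star"
    and le: "\<And>p. p \<in> A \<Longrightarrow> p = p * rp star b"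
    and sq: "\<And>p. p \<in> A \<Longrightarrow> sq_le star \<alpha> (b * p) b"
  shows "\<Squnion>\<^bsub>proj_order star\<^esub> A = \<Squnion>\<^bsub>proj_order star\<^esub> A * rp star b"
    and "sq_le star \<alpha> (b * \<Squnion>\<^bsub>proj_order star\<^esub> A) b"
proof -
  interpret projection_family star A by unfold_locales (rule A)
  let ?r = "rp star b"
  show sup_le: "psup = psup * ?r"
    using psup_least le rp_projection by blast
  have sq': "(fst \<alpha> = Star \<longrightarrow> (\<exists>q\<in>projections star. q * b = b * p)) \<and>
    (snd \<alpha> \<noteq> RightSquare \<longrightarrow> p * b * p = p * b) \<and>
    (snd \<alpha> \<noteq> LeftSquare \<longrightarrow> p * b * p = ?r * b * p)" if "p \<in> A" for p
    using sq[OF that] sq_le_mult_iff[OF member_projection[OF that] le[OF that]] by blast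
  \<comment> \<open>The left condition is tested from the left, where \<open>p * b\<close> absorbs
    \<open>p\<close> and hence \<open>psup\<close>; the right condition is tested from the
    right.\<close>
  have "psup * (b * psup) = psup * b" if "snd \<alpha> \<noteq> RightSquare"
  proof (rule psup_eqI')
    fix p assume "p \<in> A"
    then have "p * b * p = p * b" "p = p * psup"
      using sq' that psup_upper by blast+
    then show "p * (b * psup) = p * b" by (metis mult.assoc)
  qed
  moreover have "(psup * b) * psup = (?r * b) * psup" if "snd \<alpha> \<noteq> LeftSquare"
  proof (rule psup_eqI)
    fix p assume p: "p \<in> A"
    then have "p * b * p = ?r * b * p" "p = psup * p"
      using sq' that psup_upper' by blast+
    then show "(psup * b) * p = (?r * b) * p"
      using sup_le by (metis mult.assoc)
  qed
  moreover have "\<exists>q\<in>projections star. q * b = b * psup" if "fst \<alpha> = Star"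
    using intertwining_sup[OF A] sq' that by blast
  ultimately show "sq_le star \<alpha> (b * psup) b"
    unfolding sq_le_mult_iff[OF psup_projection sup_le] by (simp add: mult.assoc)
qed

lemma sq_le_inf:
  assumes A: "A \<subseteq> projections star" and ne: "A \<noteq> {}"
    and le: "\<And>p. p \<in> A \<Longrightarrow> p = p * rp star b"
    and sq: "\<And>p. p \<in> A \<Longrightarrow> sq_le star \<alpha> (b * p) b"
  shows "\<Sqinter>\<^bsub>proj_order star\<^esub> A = \<Sqinter>\<^bsub>proj_order star\<^esub> A * rp star b"
    and "sq_le star \<alpha> (b * \<Sqinter>\<^bsub>proj_order star\<^esub> A) b"
proof -
  interpret projection_family star A by unfold_locales (rule A)
  let ?r = "rp star b"
  show inf_le: "pinf = pinf * ?r"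
    \<comment> \<open>Nonemptiness enters here: the infimum of the empty family is
      \<open>unity\<close>, which need not lie below \<open>rp star b\<close>.\<close>
    using ne le pinf_lower by (metis ex_in_conv mult.assoc)
  have sq': "(fst \<alpha> = Star \<longrightarrow> (\<exists>q\<in>projections star. q * b = b * p)) \<and>
    (snd \<alpha> \<noteq> RightSquare \<longrightarrow> p * b * p = p * b) \<and>
    (snd \<alpha> \<noteq> LeftSquare \<longrightarrow> p * b * p = ?r * b * p)" if "p \<in> A" for p
    using sq[OF that] sq_le_mult_iff[OF member_projection[OF that] le[OF that]] by blast
  have "(pinf * b) * pinf = pinf * b" if "snd \<alpha> \<noteq> RightSquare"
  proof (rule mult_pinf_eq)
    fix p assume "p \<in> A"
    then have "p * b * p = p * b" "pinf = pinf * p"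
      using sq' that pinf_lower by blast+
    then show "(pinf * b) * p = pinf * b" by (metis mult.assoc)
  qed
  moreover have "(pinf * b) * pinf = (?r * b) * pinf" if "snd \<alpha> \<noteq> LeftSquare"
  proof -
    \<comment> \<open>Every \<open>p\<close> fixes \<open>?r * b * pinf\<close>, because
      \<open>p * ?r = p\<close> and \<open>p * b * p = ?r * b * p\<close>. The extra
      \<open>?r\<close> is then absorbed by \<open>pinf\<close>.\<close>
    have "pinf * (?r * b * pinf) = ?r * b * pinf"
    proof (rule pinf_mult_eq)
      fix p assume p: "p \<in> A"
      then have "p * b * p = ?r * b * p" "pinf = p * pinf"
        using sq' that pinf_lower' by blast+
      then show "p * (?r * b * pinf) = ?r * b * pinf"
        using le[OF p] by (metis mult.assoc)
    qed
    then show ?thesis using inf_le by (metis mult.assoc)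
  qed
  moreover have "\<exists>q\<in>projections star. q * b = b * pinf" if "fst \<alpha> = Star"
    using intertwining_inf[OF A] sq' that by blast
  ultimately show "sq_le star \<alpha> (b * pinf) b"
    unfolding sq_le_mult_iff[OF pinf_projection inf_le] by (simp add: mult.assoc)
qed

section \<open>Least upper and greatest lower bounds in the initial segment\<close>

lemma initial_segment_lub_glb:
  assumes "B \<noteq> {}" and B: "\<forall>c\<in>B. sq_le star \<alpha> c b"
  shows "is_lub (initial_segment star \<alpha> b) (b * \<Squnion>\<^bsub>proj_order star\<^esub> (rp star ` B)) B"
    and "is_glb (initial_segment star \<alpha> b) (b * \<Sqinter>\<^bsub>proj_order star\<^esub> (rp star ` B)) B"
proof -
  let ?A = "rp star ` B"
  have A: "?A \<subseteq> projections star" using rp_projection by blast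
  interpret projection_family star ?A by unfold_locales (rule A)
  have le: "p = p * rp star b" if "p \<in> ?A" for p
    using that B sq_leD(1) by blast
  have sq: "sq_le star \<alpha> (b * p) b" if "p \<in> ?A" for p
  proof -
    obtain c where "c \<in> B" "p = rp star c" using \<open>p \<in> ?A\<close> by blast
    then show ?thesis using B sq_leD(2)[of \<alpha> c b] by simp
  qed
  note sup = sq_le_sup[OF A le sq]
  have ne: "?A \<noteq> {}" using assms(1) by blast
  note inf = sq_le_inf[OF A ne le sq]
  \<comment> \<open>With \<open>psup\<close> and \<open>pinf\<close> recovered by \<open>rp\<close>,
    every comparison inside the segment becomes one of projections.\<close>
  have rp_sup: "rp star (b * psup) = psup"
    by (rule rp_mult_projection[OF psup_projection sup(1)])
  have rp_inf: "rp star (b * pinf) = pinf"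
    by (rule rp_mult_projection[OF pinf_projection inf(1)])
  have "sq_le star \<alpha> c (b * psup)" if "c \<in> B" for c
    using that B sq_le_interval_iff[OF _ sup(2)] psup_upper by (auto simp: rp_sup)
  moreover have "sq_le star \<alpha> (b * psup) d"
    if d: "sq_le star \<alpha> d b" and ub: "\<forall>c\<in>B. sq_le star \<alpha> c d" for d
  proof -
    have "psup = psup * rp star d"
      by (rule psup_least[OF rp_projection]) (use ub sq_leD(1) in blast)
    then show ?thesis using sq_le_interval_iff[OF sup(2) d] by (simp add: rp_sup)
  qed
  ultimately show "is_lub (initial_segment star \<alpha> b) (b * psup) B"
    using B sup(2) by (auto simp: least_def Upper_def initial_segment_def)
  have "sq_le star \<alpha> (b * pinf) c" if "c \<in> B" for c
    using that B sq_le_interval_iff[OF inf(2)] pinf_lower by (auto simp: rp_inf)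
  moreover have "sq_le star \<alpha> d (b * pinf)"
    if d: "sq_le star \<alpha> d b" and lb: "\<forall>c\<in>B. sq_le star \<alpha> d c" for d
  proof -
    have "rp star d = rp star d * pinf"
      by (rule pinf_greatest[OF rp_projection]) (use lb sq_leD(1) in blast)
    then show ?thesis using sq_le_interval_iff[OF d inf(2)] by (simp add: rp_inf)
  qed
  ultimately show "is_glb (initial_segment star \<alpha> b) (b * pinf) B"
    using B inf(2) by (auto simp: greatest_def Lower_def initial_segment_def)
qed

end

theorem theorem43:
  fixes star :: "'a::ring \<Rightarrow> 'a"
    and \<alpha> :: "base_kind \<times> square_kind"
    and b :: 'a and B :: "'a set"
  assumes "regular_baer_star_ring star"
    and "B \<noteq> {}"
    and "\<forall>c\<in>B. sq_le star \<alpha> c b"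
  shows "is_lub (initial_segment star \<alpha> b) (b * \<Squnion>\<^bsub>proj_order star\<^esub> (rp star ` B)) B
       \<and> is_glb (initial_segment star \<alpha> b) (b * \<Sqinter>\<^bsub>proj_order star\<^esub> (rp star ` B)) B"
proof -
  interpret regular_baer_star_ring star by (rule assms(1))
  show ?thesis using initial_segment_lub_glb[OF assms(2,3)] by blast
qed

end
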